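(* Let $n\ge1$, let $a=v_0<v_1<\dots<v_n=b$, let $\zeta_i\in(v_i,v_{i+1})$ for $0\le i\le n-1$, put $\zeta_{-1}=v_0$, $\zeta_n=v_n$, and let $\varphi(i)\ge 2$ be integers for $0\le i\le n$. For a sufficiently differentiable function $f$ on $[a,b]$, for $0\le i\le n$ and for $\alpha=(\alpha_1,\alpha_2)\in\mathbb{Z}_{\ge0}^2$ with $|\alpha|=\alpha_1+\alpha_2=\varphi(i)-1$, define $\nu_{i,\alpha}(f)=\mathbf{N}[f]\left(v_i,\zeta_{i-1}[\alpha_1],\zeta_i[\alpha_2]\right)$, where, for points $u,v,w\in\mathbb{R}$ with $\delta=v-u$ and $\hat\delta=w-u$, $$\mathbf{N}[f]\left(u,v[\alpha_1],w[\alpha_2]\right)=\sum_{k=0}^{\varphi(i)-1}\frac{(k+1)!}{\varphi(i)!}\sum_{\beta_1+\beta_2=\varphi(i)-1-k}\delta^{\beta_1}\,\hat\delta^{\beta_2}\,f^{(\beta_1+\beta_2)}(u),$$ the inner sum being over non-negative integers $\beta_1,\beta_2$ (with $0^0=1$). That is, $$\nu_{i,\alpha}(f)=\sum_{k=0}^{\varphi(i)-1}\frac{(k+1)!}{\varphi(i)!}\sum_{\beta_1+\beta_2=\varphi(i)-1-k}(\zeta_{i-1}-v_i)^{\beta_1}(\zeta_i-v_i)^{\beta_2}f^{(\beta_1+\beta_2)}(v_i).$$ Then the operator $$\mathcal{Q}_{\varphi,\overline{\tau}_n}f=\sum_{i=0}^{n}\ \sum_{|\alpha|=\varphi(i)-1}\nu_{i,\alpha}(f)\,\mathcal{N}_{i,\alpha}$$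 satisfies $\mathcal{Q}_{\varphi,\overline{\tau}_n}\tilde p=\tilde p$ for all $\tilde p\in\mathbb{P}_{\min_{0\le i\le n}\varphi(i)}$.
   Context: $\mathbb{P}_d$ is the space of real polynomials of degree $\le d$. The notation $x[\ell]$ means that the argument $x$ is repeated $\ell$ times. The space $\mathcal{S}^1(\varphi,\overline{\tau}_n)$ consists of all functions $s:[a,b]\to\mathbb{R}$ such that: (i) for each $0\le i\le n$, the restrictions of $s$ to $[\zeta_{i-1},v_i]$ and to $[v_i,\zeta_i]$ (when non-degenerate) are in $\mathbb{P}_{\varphi(i)}$; (ii) $s$ is $\mathcal{C}^{\varphi(i)-1}$ at $v_i$ for $0<i<n$; (iii) $s$ is $\mathcal{C}^1$ at $\zeta_i$ for $0\le i\le n-1$ ("$\mathcal{C}^r$ at a point" means that the derivatives of orders $0,\dots,r$ of the two adjacent polynomial pieces agree there). A function $s\in\mathcal{S}^1(\varphi,\overline{\tau}_n)$ exists and is unique with arbitrarily prescribed values $s^{(j)}(v_i)$, $0\le i\le n$, $0\le j\le\varphi(i)-1$ (one-sided derivatives at $a$, $b$). For a multi-index $\alpha=(\alpha_1,\alpha_2)\in\mathbb{Z}_{\ge0}^2$ with $|\alpha|=\alpha_1+\alpha_2=d$ and an interval $[A,B]$, the Bernstein polynomial is $\mathfrak{B}^d_{\alpha,[A,B]}(v)=\frac{d!}{\alpha_1!\alpha_2!}\frac{(B-v)^{\alpha_1}(v-A)^{\alpha_2}}{(B-A)^d}$. For $0\le i\le n$ let $\theta_i=\frac{\varphi(i)-1}{\varphi(i)}$,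 $S_{i,1}=\theta_i\zeta_{i-1}+(1-\theta_i)v_i$, $S_{i,2}=\theta_i\zeta_i+(1-\theta_i)v_i$, and $S_i=[S_{i,1},S_{i,2}]$ (so $S_{0,1}=v_0$ and $S_{n,2}=v_n$). For $|\alpha|=\varphi(i)-1$ and $0\le j\le\varphi(i)-1$ set $$\gamma_{i,\alpha}^j=\frac{\binom{\varphi(i)}{j}}{\binom{\varphi(i)-1}{j}}\,\theta_i^j\,\bigl(\mathfrak{B}^{\varphi(i)-1}_{\alpha,S_i}\bigr)^{(j)}(v_i).$$ The B-spline-like function $\mathcal{N}_{i,\alpha}$ is the unique element of $\mathcal{S}^1(\varphi,\overline{\tau}_n)$ with $\mathcal{N}_{i,\alpha}^{(j)}(v_i)=\gamma_{i,\alpha}^j$ for $0\le j\le\varphi(i)-1$ and $\mathcal{N}_{i,\alpha}^{(j)}(v_k)=0$ for $k\ne i$, $0\le j\le\varphi(k)-1$.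
   Formalization: The displayed formula for N[f] (hence ν_{i,α}) does not depend on α and makes the claim false (e.g. for p(x)=x); the formal version multiplies each inner summand by binom(α_1,β_1)·binom(α_2,β_2), the multiplicities given by the repeated arguments. *)

theory Defs
  imports "HOL-Analysis.Analysis" "HOL-Computational_Algebra.Polynomial"
begin

text \<open>
  The refined partition is given by the number \<open>n\<close>, the nodes \<open>v 0 < ... < v n\<close> and the split
  points \<open>\<zeta> i\<close> for \<open>i < n\<close>.  The conventions \<open>\<zeta>\<^sub>-\<^sub>1 = v 0\<close> and \<open>\<zeta>\<^sub>n = v n\<close> are
  built into the following two functions, which stand for \<open>\<zeta>\<^sub>i\<^sub>-\<^sub>1\<close> and \<open>\<zeta>\<^sub>i\<close>.
\<close>

definition zeta_left :: "(nat \<Rightarrow> real) \<Rightarrow> (nat \<Rightarrow> real) \<Rightarrow> nat \<Rightarrow> real" where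
  "zeta_left v \<zeta> i = (if i = 0 then v 0 else \<zeta> (i - 1))"

definition zeta_right :: "nat \<Rightarrow> (nat \<Rightarrow> real) \<Rightarrow> (nat \<Rightarrow> real) \<Rightarrow> nat \<Rightarrow> real" where
  "zeta_right n v \<zeta> i = (if i < n then \<zeta> i else v n)"

text \<open>
  Derivative of order \<open>j\<close> of a function on \<open>[a,b]\<close>, one-sided at \<open>a\<close> and \<open>b\<close>.
\<close>

definition deriv_on :: "real \<Rightarrow> real \<Rightarrow> nat \<Rightarrow> (real \<Rightarrow> real) \<Rightarrow> real \<Rightarrow> real" where
  "deriv_on a b j f = ((\<lambda>g x. vector_derivative g (at x within {a..b})) ^^ j) f"

definition multi_indices :: "nat \<Rightarrow> (nat \<times> nat) set" where
  "multi_indices d = {\<alpha>. fst \<alpha> + snd \<alpha> = d}"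

text \<open>
  Functions on \<open>[v 0, v n]\<close> are made extensional (\<open>undefined\<close> outside the interval), so that
  ``the unique element'' below is meaningful.  The polynomials \<open>L i\<close> and \<open>R i\<close> are the pieces
  to the left and to the right of \<open>v i\<close>; \<open>L 0\<close> and \<open>R n\<close> belong to degenerate intervals and
  are not constrained by \<open>s\<close>.
\<close>

definition spline_space ::
  "nat \<Rightarrow> (nat \<Rightarrow> real) \<Rightarrow> (nat \<Rightarrow> real) \<Rightarrow> (nat \<Rightarrow> nat) \<Rightarrow> (real \<Rightarrow> real) set" where
  "spline_space n v \<zeta> \<phi> =
    {s \<in> extensional {v 0..v n}. \<exists>L R :: nat \<Rightarrow> real poly.
      (\<forall>i\<le>n. degree (L i) \<le> \<phi> i \<and> degree (R i) \<le> \<phi> i \<and>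
         (zeta_left v \<zeta> i < v i \<longrightarrow> (\<forall>x\<in>{zeta_left v \<zeta> i..v i}. s x = poly (L i) x)) \<and>
         (v i < zeta_right n v \<zeta> i \<longrightarrow> (\<forall>x\<in>{v i..zeta_right n v \<zeta> i}. s x = poly (R i) x))) \<and>
      (\<forall>i. 0 < i \<and> i < n \<longrightarrow>
         (\<forall>r\<le>\<phi> i - 1. poly ((pderiv ^^ r) (L i)) (v i) = poly ((pderiv ^^ r) (R i)) (v i))) \<and>
      (\<forall>i<n. \<forall>r\<le>1.
         poly ((pderiv ^^ r) (R i)) (\<zeta> i) = poly ((pderiv ^^ r) (L (Suc i))) (\<zeta> i))}"

definition bernstein_on :: "nat \<Rightarrow> nat \<times> nat \<Rightarrow> real \<Rightarrow> real \<Rightarrow> real \<Rightarrow> real" where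
  "bernstein_on d \<alpha> A B x =
     fact d / (fact (fst \<alpha>) * fact (snd \<alpha>)) *
     ((B - x) ^ fst \<alpha> * (x - A) ^ snd \<alpha>) / (B - A) ^ d"

definition theta :: "(nat \<Rightarrow> nat) \<Rightarrow> nat \<Rightarrow> real" where
  "theta \<phi> i = (real (\<phi> i) - 1) / real (\<phi> i)"

definition S_left :: "(nat \<Rightarrow> real) \<Rightarrow> (nat \<Rightarrow> real) \<Rightarrow> (nat \<Rightarrow> nat) \<Rightarrow> nat \<Rightarrow> real" where
  "S_left v \<zeta> \<phi> i = theta \<phi> i * zeta_left v \<zeta> i + (1 - theta \<phi> i) * v i"

definition S_right :: "nat \<Rightarrow> (nat \<Rightarrow> real) \<Rightarrow> (nat \<Rightarrow> real) \<Rightarrow> (nat \<Rightarrow> nat) \<Rightarrow> nat \<Rightarrow> real" where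
  "S_right n v \<zeta> \<phi> i = theta \<phi> i * zeta_right n v \<zeta> i + (1 - theta \<phi> i) * v i"

definition gamma_coeff ::
  "nat \<Rightarrow> (nat \<Rightarrow> real) \<Rightarrow> (nat \<Rightarrow> real) \<Rightarrow> (nat \<Rightarrow> nat) \<Rightarrow> nat \<Rightarrow> nat \<times> nat \<Rightarrow> nat \<Rightarrow> real" where
  "gamma_coeff n v \<zeta> \<phi> i \<alpha> j =
     real (\<phi> i choose j) / real ((\<phi> i - 1) choose j) * theta \<phi> i ^ j *
     (deriv ^^ j) (bernstein_on (\<phi> i - 1) \<alpha> (S_left v \<zeta> \<phi> i) (S_right n v \<zeta> \<phi> i)) (v i)"

definition bspline ::
  "nat \<Rightarrow> (nat \<Rightarrow> real) \<Rightarrow> (nat \<Rightarrow> real) \<Rightarrow> (nat \<Rightarrow> nat) \<Rightarrow> nat \<Rightarrow> nat \<times> nat \<Rightarrow> real \<Rightarrow> real" where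
  "bspline n v \<zeta> \<phi> i \<alpha> =
     (THE s. s \<in> spline_space n v \<zeta> \<phi> \<and>
        (\<forall>j\<le>\<phi> i - 1. deriv_on (v 0) (v n) j s (v i) = gamma_coeff n v \<zeta> \<phi> i \<alpha> j) \<and>
        (\<forall>k\<le>n. k \<noteq> i \<longrightarrow> (\<forall>j\<le>\<phi> k - 1. deriv_on (v 0) (v n) j s (v k) = 0)))"

text \<open>
  \<open>blossom_at a b m f u y z \<alpha>\<close> is \<open>N[f](u, y[\<alpha>\<^sub>1], z[\<alpha>\<^sub>2])\<close> with \<open>\<alpha>\<^sub>1 + \<alpha>\<^sub>2 = m - 1\<close>:
  the symmetric \<open>m\<close>-affine form of the degree \<open>m\<close> Taylor polynomial of \<open>f\<close> at \<open>u\<close>.  As the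
  argument \<open>y\<close> is repeated \<open>\<alpha>\<^sub>1\<close> times and \<open>z\<close> is repeated \<open>\<alpha>\<^sub>2\<close> times, the monomial
  with exponents \<open>\<beta>\<close> arises from \<open>(\<alpha>\<^sub>1 choose \<beta>\<^sub>1) (\<alpha>\<^sub>2 choose \<beta>\<^sub>2)\<close> choices of
  arguments.  Without these multiplicities the value would not depend on \<open>\<alpha>\<close> at all, and the
  operator below would not even reproduce the identity function.
\<close>

definition blossom_at ::
  "real \<Rightarrow> real \<Rightarrow> nat \<Rightarrow> (real \<Rightarrow> real) \<Rightarrow> real \<Rightarrow> real \<Rightarrow> real \<Rightarrow> nat \<times> nat \<Rightarrow> real" where
  "blossom_at a b m f u y z \<alpha> =
     (\<Sum>k=0..m - 1. fact (k + 1) / fact m *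
        (\<Sum>\<beta>\<in>multi_indices (m - 1 - k).
           real (fst \<alpha> choose fst \<beta>) * real (snd \<alpha> choose snd \<beta>) *
           (y - u) ^ fst \<beta> * (z - u) ^ snd \<beta> * deriv_on a b (fst \<beta> + snd \<beta>) f u))"

definition nu ::
  "nat \<Rightarrow> (nat \<Rightarrow> real) \<Rightarrow> (nat \<Rightarrow> real) \<Rightarrow> (nat \<Rightarrow> nat) \<Rightarrow> nat \<Rightarrow> nat \<times> nat \<Rightarrow> (real \<Rightarrow> real) \<Rightarrow> real" where
  "nu n v \<zeta> \<phi> i \<alpha> f =
     blossom_at (v 0) (v n) (\<phi> i) f (v i) (zeta_left v \<zeta> i) (zeta_right n v \<zeta> i) \<alpha>"

definition quasi_interpolant ::
  "nat \<Rightarrow> (nat \<Rightarrow> real) \<Rightarrow> (nat \<Rightarrow> real) \<Rightarrow> (nat \<Rightarrow> nat) \<Rightarrow> (real \<Rightarrow> real) \<Rightarrow> real \<Rightarrow> real" where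
  "quasi_interpolant n v \<zeta> \<phi> f x =
     (\<Sum>i=0..n. \<Sum>\<alpha>\<in>multi_indices (\<phi> i - 1). nu n v \<zeta> \<phi> i \<alpha> f * bspline n v \<zeta> \<phi> i \<alpha> x)"

end

theory Submission
  imports Defs
begin

text \<open>
  Both \<open>p\<close> and its quasi-interpolant are splines, and a spline is determined by its derivatives at
  the nodes \<open>v\<^sub>i\<close> of orders below \<open>\<phi> i\<close>: on \<open>[v\<^sub>i, v\<^sub>i\<^sub>+\<^sub>1]\<close> they leave two coefficients free, and the
  two C1 conditions at \<open>\<zeta>\<^sub>i\<close> form a regular linear system for these. So it suffices to compare
  derivatives at a single node \<open>u\<close>. Write \<open>m = \<phi> i\<close>. There the \<open>\<nu>\<^sub>i\<^sub>,\<^sub>\<alpha>(p)\<close> are combinations of elementary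
  symmetric polynomials in \<open>\<delta>[\<alpha>\<^sub>1], \<epsilon>[\<alpha>\<^sub>2]\<close>, with \<open>\<delta>, \<epsilon>\<close> the offsets of the adjacent split points;
  comparing coefficients of \<open>X\<^sup>l\<close> in \<open>(s(1 + \<delta>X) + t(1 + \<epsilon>X))\<^sup>m\<^sup>-\<^sup>1\<close>, where \<open>s + t = 1\<close>, sums them
  against the Bernstein polynomials to multiples of \<open>((x - u)/\<theta>)\<^sup>l\<close>, and the factors in
  \<open>\<gamma>\<close> turn these multiples into the derivatives of \<open>p\<close> at \<open>u\<close>.
\<close>

subsection \<open>Expansions around a point\<close>

lemma higher_pderiv_shift:
  "(pderiv ^^ j) (pcompose p [:u, 1:]) = pcompose ((pderiv ^^ j) p) [:u, 1:]"
  for p :: "real poly"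
  by (induction j) (simp_all add: pderiv_pcompose pderiv_pCons)

text \<open>Substituting X + u moves the expansion point to 0, so Taylor coefficients at
  \<open>u\<close> become ordinary coefficients of the shifted polynomial.\<close>

lemma poly_higher_pderiv_eq_coeff:
  "poly ((pderiv ^^ j) p) u = fact j * coeff (pcompose p [:u, 1:]) j" for p :: "real poly"
proof -
  have "poly ((pderiv ^^ j) p) u = coeff ((pderiv ^^ j) (pcompose p [:u, 1:])) 0"
    by (simp add: higher_pderiv_shift flip: poly_0_coeff_0) (simp add: poly_pcompose)
  then show ?thesis
    by (simp add: coeff_higher_pderiv pochhammer_fact)
qed

lemma pcompose_linear_power_shift: "pcompose ([:- u, 1:] ^ l) [:u, 1:] = monom 1 l" for u :: real
proof -
  have "pcompose ([:- u, 1:] ^ l) [:u, 1:] = (pcompose [:- u, 1:] [:u, 1:]) ^ l"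
    by (induction l) (simp_all add: pcompose_mult pcompose_1 del: mult_pCons_left mult_pCons_right)
  then show ?thesis
    by (simp add: pcompose_pCons monom_altdef)
qed

lemma poly_higher_pderiv_taylor:
  fixes c :: "nat \<Rightarrow> real"
  shows "poly ((pderiv ^^ j) (\<Sum>l<N. smult (c l) ([:- u, 1:] ^ l))) u = (if j < N then fact j * c j else 0)"
  unfolding poly_higher_pderiv_eq_coeff pcompose_sum pcompose_smult pcompose_linear_power_shift
  by (simp add: coeff_sum if_distrib cong: if_cong)

lemma higher_pderiv_diff: "(pderiv ^^ j) (p - q) = (pderiv ^^ j) p - (pderiv ^^ j) q"
  for p q :: "real poly"
  by (induction j) (simp_all add: pderiv_diff)

lemma poly_higher_pderiv_linear_power:
  "j \<noteq> m \<Longrightarrow> poly ((pderiv ^^ j) ([:- u, 1:] ^ m)) u = 0" for u :: real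
  by (simp add: poly_higher_pderiv_eq_coeff pcompose_linear_power_shift)

lemma degree_taylor: "degree (\<Sum>l<N. smult (c l) ([:- u, 1:] ^ l)) \<le> N" for u :: real
proof (rule degree_sum_le)
  fix l assume "l \<in> {..<N}"
  then show "degree (smult (c l) ([:- u, 1:] ^ l)) \<le> N"
    using degree_linear_power[of "- u" l] by (intro order_trans[OF degree_smult_le]) simp
qed simp

text \<open>Supplies the slope entries of the system at a split point. For m = 0 the factor
  \<open>real m\<close> absorbs the truncated exponent \<open>m - 1\<close>.\<close>

lemma pderiv_linear_power:
  "poly (pderiv ([:- u, 1:] ^ m)) x = real m * (x - u) ^ (m - 1)" for u x :: real
  by (cases m) (simp_all only: pderiv_power_Suc, simp_all add: pderiv_pCons pderiv_1 algebra_simps del: mult_pCons_left mult_pCons_right)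

text \<open>After the shift to \<open>u\<close>, coefficients below m vanish by \<open>zero\<close>
  and those above m by \<open>deg\<close>. Applied to the difference of two pieces with equal
  Hermite data, this isolates the one coefficient that the data leave free.\<close>

lemma poly_with_high_order_zero:
  fixes p :: "real poly"
  assumes deg: "degree p \<le> m" and zero: "\<And>j. j < m \<Longrightarrow> poly ((pderiv ^^ j) p) u = 0"
  obtains e where "p = smult e ([:- u, 1:] ^ m)"
proof
  let ?q = "pcompose p [:u, 1:]"
  have "?q = monom (coeff ?q m) m"
  proof (rule poly_eqI)
    fix j
    show "coeff ?q j = coeff (monom (coeff ?q m) m) j"
    proof (cases j m rule: linorder_cases)
      case less
      then show ?thesis using zero[of j] by (simp add: poly_higher_pderiv_eq_coeff)
    next
      case greater
      then show ?thesis using deg by (simp add: degree_pcompose coeff_eq_0)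
    qed simp
  qed
  also have "\<dots> = pcompose (smult (coeff ?q m) ([:- u, 1:] ^ m)) [:u, 1:]"
    by (simp add: pcompose_smult pcompose_linear_power_shift smult_monom)
  \<comment> \<open>Composition with X - u undoes the shift on both sides.\<close>
  finally have "pcompose ?q [:- u, 1:] =
      pcompose (pcompose (smult (coeff ?q m) ([:- u, 1:] ^ m)) [:u, 1:]) [:- u, 1:]"
    by simp
  then show "p = smult (coeff ?q m) ([:- u, 1:] ^ m)"
    by (simp add: pcompose_pCons flip: pcompose_assoc)
qed

text \<open>The 2 by 2 system matching values and slopes at a split point, where \<open>h\<close> and \<open>k\<close> are its
  signed distances to the adjacent nodes; the signs make the determinant nonzero.\<close>

lemma split_system_det:
  fixes h k :: real
  assumes "h > 0" "k < 0" "m > 0" "m' > 0"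
  shows "real m * h ^ (m - 1) * k ^ m' - real m' * k ^ (m' - 1) * h ^ m \<noteq> 0"
proof -
  have "real m * h ^ (m - 1) * k ^ m' - real m' * k ^ (m' - 1) * h ^ m
    = h ^ (m - 1) * k ^ (m' - 1) * (real m * k - real m' * h)"
    using assms by (cases m; cases m') (simp_all add: algebra_simps)
  moreover have "real m * k < real m' * h"
    using assms mult_pos_neg[of "real m" k] mult_pos_pos[of "real m'" h] by linarith
  ultimately show ?thesis
    using assms by (simp only: mult_eq_0_iff power_eq_0_iff) auto
qed

lemma linear_system_2_solvable:
  fixes a b c d r s :: real
  assumes "a * d - b * c \<noteq> 0"
  obtains x y where "a * x + b * y = r" "c * x + d * y = s"
proof
  \<comment> \<open>Cramer's rule.\<close>
  show "a * ((d * r - b * s) / (a * d - b * c)) + b * ((a * s - c * r) / (a * d - b * c)) = r"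
    "c * ((d * r - b * s) / (a * d - b * c)) + d * ((a * s - c * r) / (a * d - b * c)) = s"
    using assms by (simp_all add: divide_simps) (simp_all add: algebra_simps)
qed

lemma linear_system_2_unique:
  fixes a b c d x y :: real
  assumes "a * d - b * c \<noteq> 0" "a * x + b * y = 0" "c * x + d * y = 0"
  shows "x = 0" "y = 0"
proof -
  \<comment> \<open>Multiplication by the adjugate matrix expresses each unknown, times the
    determinant, through the two equations.\<close>
  have "(a * d - b * c) * x = d * (a * x + b * y) - b * (c * x + d * y)"
    "(a * d - b * c) * y = a * (c * x + d * y) - c * (a * x + b * y)"
    by (simp_all add: algebra_simps)
  with assms show "x = 0" "y = 0" by auto
qed

subsection \<open>Derivatives of piecewise polynomials\<close>

text \<open>The bounds \<open>lo\<close>, \<open>hi\<close> may lie outside \<open>[a, b]\<close>, which covers one-sided derivatives at \<open>u = a\<close>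
  and \<open>u = b\<close> with \<open>P = R\<close>.\<close>

lemma deriv_on_piecewise:
  fixes P R :: "real poly"
  assumes ab: "a < b"
    and pw: "\<And>x. x \<in> {a..b} \<Longrightarrow> lo < x \<Longrightarrow> x < hi \<Longrightarrow> s x = (if x \<le> u then poly P x else poly R x)"
    and eq: "\<And>r. r \<le> m \<Longrightarrow> poly ((pderiv ^^ r) P) u = poly ((pderiv ^^ r) R) u"
    and j: "j \<le> m"
    and x: "x \<in> {a..b}" "lo < x" "x < hi"
  shows "deriv_on a b j s x = (if x \<le> u then poly ((pderiv ^^ j) P) x else poly ((pderiv ^^ j) R) x)"
  using j x
proof (induction j arbitrary: x)
  case 0
  then show ?case by (simp add: deriv_on_def pw)
next
  case (Suc j)
  define g where "g = deriv_on a b j s"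
  have S: "deriv_on a b (Suc j) s x = vector_derivative g (at x within {a..b})"
    by (simp add: deriv_on_def g_def)
  let ?P = "(pderiv ^^ j) P" and ?R = "(pderiv ^^ j) R"
  have vd: "(poly Q has_vector_derivative poly (pderiv Q) y) (at y within S)" for Q :: "real poly" and y S
    using poly_DERIV[of Q y] has_vector_derivative_at_within has_real_derivative_iff_has_vector_derivative by blast
  \<comment> \<open>At \<open>u\<close> the branches agree in orders j and j + 1, the latter because
    \<open>Suc j\<close> is still at most \<open>m\<close>; hence they glue to a differentiable
    function.\<close>
  have "((\<lambda>y. if y \<in> {..u} then poly ?P y else poly ?R y) has_vector_derivative
      (if x \<in> {..u} then poly (pderiv ?P) x else poly (pderiv ?R) x)) (at x within UNIV)"
    using eq[of j] eq[of "Suc j"] Suc.prems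
    by (intro has_vector_derivative_If_within_closures[where T = "{u<..}"] vd) auto
  then have *: "((\<lambda>y. if y \<le> u then poly ?P y else poly ?R y) has_vector_derivative
      (if x \<le> u then poly (pderiv ?P) x else poly (pderiv ?R) x)) (at x within {a..b})"
    by (simp only: atMost_iff has_vector_derivative_at_within)
  have "(g has_vector_derivative (if x \<le> u then poly (pderiv ?P) x else poly (pderiv ?R) x)) (at x within {a..b})"
  proof (rule has_vector_derivative_transform_within[OF *])
    \<comment> \<open>The induction hypothesis describes \<open>g\<close> only inside the window
      (lo, hi), so the derivative is transferred on a ball that stays in it.\<close>
    show "0 < min (x - lo) (hi - x)" using Suc.prems by simp
    fix y assume "y \<in> {a..b}" "dist y x < min (x - lo) (hi - x)"
    then show "(if y \<le> u then poly ?P y else poly ?R y) = g y"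
      using Suc by (auto simp: g_def dist_real_def)
  qed (use Suc.prems in auto)
  from vector_derivative_within_closed_interval[OF ab Suc.prems(2) this] show ?case
    by (simp add: S)
qed

subsection \<open>Bernstein expansion of the elementary symmetric polynomials\<close>

lemma finite_multi_indices [simp]: "finite (multi_indices d)"
  by (rule finite_subset[of _ "{..d} \<times> {..d}"]) (auto simp: multi_indices_def)

lemma sum_multi_indices: "(\<Sum>\<alpha>\<in>multi_indices d. f \<alpha>) = (\<Sum>i\<le>d. f (i, d - i))"
  by (rule sum.reindex_bij_witness[of _ "\<lambda>i. (i, d - i)" fst]) (auto simp: multi_indices_def)

text \<open>The arguments are \<open>\<delta>\<close> repeated \<open>\<alpha>\<^sub>1\<close> times and \<open>\<epsilon>\<close> repeated \<open>\<alpha>\<^sub>2\<close> times.\<close>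

definition elem_sym :: "nat \<Rightarrow> real \<Rightarrow> real \<Rightarrow> nat \<times> nat \<Rightarrow> real" where
  "elem_sym l \<delta> \<epsilon> \<alpha> = (\<Sum>\<beta>\<in>multi_indices l.
     real (fst \<alpha> choose fst \<beta>) * real (snd \<alpha> choose snd \<beta>) * \<delta> ^ fst \<beta> * \<epsilon> ^ snd \<beta>)"

lemma coeff_one_plus_power: "coeff ([:1, c:] ^ n) k = real (n choose k) * c ^ k" for c :: real
proof (cases "k \<le> n")
  case True
  then show ?thesis by (simp add: coeff_linear_poly_power)
next
  case False
  have "degree ([:1, c:] ^ n) \<le> 1 * n"
    by (rule order_trans[OF degree_power_le]) simp
  with False show ?thesis by (simp add: coeff_eq_0)
qed

text \<open>The product of the factors 1 + yX over all arguments y generates their elementary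
  symmetric polynomials; the Cauchy product of its two binomial expansions is the defining
  sum.\<close>

lemma elem_sym_eq_coeff: "elem_sym l \<delta> \<epsilon> \<alpha> = coeff ([:1, \<delta>:] ^ fst \<alpha> * [:1, \<epsilon>:] ^ snd \<alpha>) l"
  by (simp add: elem_sym_def sum_multi_indices coeff_mult coeff_one_plus_power mult_ac)

lemma sum_elem_sym_binomial:
  fixes s t :: real
  assumes "s + t = 1"
  shows "(\<Sum>\<alpha>\<in>multi_indices d. elem_sym l \<delta> \<epsilon> \<alpha> * (real (d choose fst \<alpha>) * s ^ fst \<alpha> * t ^ snd \<alpha>))
    = real (d choose l) * (s * \<delta> + t * \<epsilon>) ^ l"
proof -
  \<comment> \<open>The constant term on the right is s + t = 1; expanding it by the binomial
    theorem then gives the claim coefficientwise.\<close>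
  have "[:1, s * \<delta> + t * \<epsilon>:] ^ d = (smult s [:1, \<delta>:] + smult t [:1, \<epsilon>:]) ^ d"
    using assms by simp
  also have "\<dots> = (\<Sum>i\<le>d. smult (real (d choose i) * s ^ i * t ^ (d - i)) ([:1, \<delta>:] ^ i * [:1, \<epsilon>:] ^ (d - i)))"
    unfolding binomial_ring smult_power of_nat_poly
    by (intro sum.cong) (simp_all add: mult_ac del: smult_pCons)
  finally have "coeff ([:1, s * \<delta> + t * \<epsilon>:] ^ d) l =
     (\<Sum>i\<le>d. real (d choose i) * s ^ i * t ^ (d - i) * coeff ([:1, \<delta>:] ^ i * [:1, \<epsilon>:] ^ (d - i)) l)"
    by (simp add: coeff_sum)
  then show ?thesis
    by (simp add: coeff_one_plus_power sum_multi_indices elem_sym_eq_coeff mult_ac)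
qed

text \<open>With \<open>s\<close>, \<open>t\<close> the barycentric coordinates of \<open>x\<close>
  with respect to A and B, the map from \<open>x\<close> to s\<delta> + t\<epsilon> is affine and
  sends A to \<delta> and B to \<epsilon>. So it inverts y -> u + \<theta>y, and the Bernstein
  polynomials are the binomial weights in \<open>s\<close> and \<open>t\<close>.\<close>

lemma sum_elem_sym_bernstein:
  assumes "\<theta> \<noteq> 0" "\<delta> \<noteq> \<epsilon>"
  shows "(\<Sum>\<alpha>\<in>multi_indices d. elem_sym l \<delta> \<epsilon> \<alpha> * bernstein_on d \<alpha> (u + \<theta> * \<delta>) (u + \<theta> * \<epsilon>) x)
    = real (d choose l) * ((x - u) / \<theta>) ^ l"
proof -
  define A B where "A = u + \<theta> * \<delta>" and "B = u + \<theta> * \<epsilon>"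
  define s t where "s = (B - x) / (B - A)" and "t = (x - A) / (B - A)"
  have BA: "B - A = \<theta> * (\<epsilon> - \<delta>)" by (simp add: A_def B_def algebra_simps)
  then have nz: "B - A \<noteq> 0" using assms by simp
  have st: "s + t = 1" using nz by (simp add: s_def t_def flip: add_divide_distrib)
  have "s * \<delta> + t * \<epsilon> = ((B - x) * \<delta> + (x - A) * \<epsilon>) / (B - A)"
    by (simp add: s_def t_def add_divide_distrib)
  also have "(B - x) * \<delta> + (x - A) * \<epsilon> = (x - u) * (\<epsilon> - \<delta>)"
    by (simp add: A_def B_def algebra_simps)
  also have "\<dots> / (B - A) = (x - u) / \<theta>"
    using assms by (simp add: BA)
  finally have w: "s * \<delta> + t * \<epsilon> = (x - u) / \<theta>" .
  have "bernstein_on d \<alpha> A B x = real (d choose fst \<alpha>) * s ^ fst \<alpha> * t ^ snd \<alpha>"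
    if "\<alpha> \<in> multi_indices d" for \<alpha>
  proof -
    have d: "fst \<alpha> + snd \<alpha> = d" using that by (simp add: multi_indices_def)
    then have "real (d choose fst \<alpha>) = fact d / (fact (fst \<alpha>) * fact (snd \<alpha>))"
      using binomial_fact[of "fst \<alpha>" d, where 'a = real] by force
    moreover have "s ^ fst \<alpha> * t ^ snd \<alpha> = ((B - x) ^ fst \<alpha> * (x - A) ^ snd \<alpha>) / (B - A) ^ d"
      by (simp add: s_def t_def power_divide power_add flip: d)
    ultimately show ?thesis
      unfolding bernstein_on_def mult.assoc by simp
  qed
  then show ?thesis
    using sum_elem_sym_binomial[OF st, of l \<delta> \<epsilon> d] by (simp add: A_def B_def w)
qed

lemma bernstein_on_eq_poly: "\<exists>p. bernstein_on d \<alpha> A B = poly p"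
proof
  show "bernstein_on d \<alpha> A B =
      poly (smult (fact d / (fact (fst \<alpha>) * fact (snd \<alpha>)) / (B - A) ^ d)
         ([:B, -1:] ^ fst \<alpha> * [:- A, 1:] ^ snd \<alpha>))"
    by (auto simp: bernstein_on_def fun_eq_iff)
qed

lemma deriv_poly: "(deriv ^^ j) (poly p) = poly ((pderiv ^^ j) p)" for p :: "real poly"
proof (induction j)
  case (Suc j)
  show ?case
    unfolding funpow.simps o_def Suc by (auto intro: DERIV_imp_deriv poly_DERIV)
qed simp

lemma sum_elem_sym_deriv_bernstein:
  assumes "\<theta> \<noteq> 0" "\<delta> \<noteq> \<epsilon>" "j < N"
  shows "(\<Sum>\<alpha>\<in>multi_indices d. (\<Sum>l<N. c l * elem_sym l \<delta> \<epsilon> \<alpha>) *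
       (deriv ^^ j) (bernstein_on d \<alpha> (u + \<theta> * \<delta>) (u + \<theta> * \<epsilon>)) u)
    = fact j * c j * real (d choose j) / \<theta> ^ j"
proof -
  obtain b where b: "\<And>\<alpha>. bernstein_on d \<alpha> (u + \<theta> * \<delta>) (u + \<theta> * \<epsilon>) = poly (b \<alpha>)"
    using choice[of "\<lambda>\<alpha> p. bernstein_on d \<alpha> (u + \<theta> * \<delta>) (u + \<theta> * \<epsilon>) = poly p"]
      bernstein_on_eq_poly by blast
  let ?T = "\<Sum>l<N. smult (c l * real (d choose l) / \<theta> ^ l) ([:- u, 1:] ^ l)"
  have "(\<Sum>\<alpha>\<in>multi_indices d. smult (\<Sum>l<N. c l * elem_sym l \<delta> \<epsilon> \<alpha>) (b \<alpha>)) = ?T" (is "?S = _")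
  proof -
    \<comment> \<open>Real polynomials that agree at every point are equal, so this pointwise
      identity may be differentiated formally.\<close>
    have "poly ?S x = poly ?T x" for x
    proof -
      have "poly ?S x = (\<Sum>\<alpha>\<in>multi_indices d. \<Sum>l<N. c l * (elem_sym l \<delta> \<epsilon> \<alpha> * poly (b \<alpha>) x))"
        by (simp add: poly_sum sum_distrib_right mult.assoc)
      also have "\<dots> = (\<Sum>l<N. c l * (\<Sum>\<alpha>\<in>multi_indices d. elem_sym l \<delta> \<epsilon> \<alpha> * poly (b \<alpha>) x))"
        by (subst sum.swap) (simp add: sum_distrib_left)
      also have "\<dots> = poly ?T x"
        using sum_elem_sym_bernstein[OF assms(1,2), of _ d u x]
        by (simp add: b poly_sum poly_power power_divide mult.assoc)
      finally show ?thesis .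
    qed
    then show ?thesis
      using poly_eq_poly_eq_iff by blast
  qed
  moreover have "(\<Sum>\<alpha>\<in>multi_indices d. (\<Sum>l<N. c l * elem_sym l \<delta> \<epsilon> \<alpha>) *
       (deriv ^^ j) (bernstein_on d \<alpha> (u + \<theta> * \<delta>) (u + \<theta> * \<epsilon>)) u) = poly ((pderiv ^^ j) ?S) u"
    by (simp add: b deriv_poly higher_pderiv_sum higher_pderiv_smult poly_sum)
  ultimately show ?thesis
    using assms(3) by (simp add: poly_higher_pderiv_taylor)
qed

subsection \<open>Hermite interpolation by splines\<close>

locale refined_partition =
  fixes n :: nat and v \<zeta> :: "nat \<Rightarrow> real" and \<phi> :: "nat \<Rightarrow> nat"
  assumes n_pos: "n \<ge> 1"
    and v_less: "\<And>i. i < n \<Longrightarrow> v i < v (Suc i)"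
    and split_point: "\<And>i. i < n \<Longrightarrow> \<zeta> i \<in> {v i<..<v (Suc i)}"
    and \<phi>_ge: "\<And>i. i \<le> n \<Longrightarrow> \<phi> i \<ge> 2"
begin

text \<open>The condition of \<open>spline_space\<close> with the pieces exposed and extensionality
  dropped: \<open>poly p\<close> and linear combinations of B-splines are not extensional, yet have
  to be compared as splines.\<close>

definition pieces :: "(real \<Rightarrow> real) \<Rightarrow> (nat \<Rightarrow> real poly) \<Rightarrow> (nat \<Rightarrow> real poly) \<Rightarrow> bool" where
  "pieces s L R \<longleftrightarrow>
      (\<forall>i\<le>n. degree (L i) \<le> \<phi> i \<and> degree (R i) \<le> \<phi> i \<and>
         (zeta_left v \<zeta> i < v i \<longrightarrow> (\<forall>x\<in>{zeta_left v \<zeta> i..v i}. s x = poly (L i) x)) \<and>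
         (v i < zeta_right n v \<zeta> i \<longrightarrow> (\<forall>x\<in>{v i..zeta_right n v \<zeta> i}. s x = poly (R i) x))) \<and>
      (\<forall>i. 0 < i \<and> i < n \<longrightarrow>
         (\<forall>r\<le>\<phi> i - 1. poly ((pderiv ^^ r) (L i)) (v i) = poly ((pderiv ^^ r) (R i)) (v i))) \<and>
      (\<forall>i<n. \<forall>r\<le>1.
         poly ((pderiv ^^ r) (R i)) (\<zeta> i) = poly ((pderiv ^^ r) (L (Suc i))) (\<zeta> i))"

lemma spline_space_iff:
  "s \<in> spline_space n v \<zeta> \<phi> \<longleftrightarrow> s \<in> extensional {v 0..v n} \<and> (\<exists>L R. pieces s L R)"
  by (simp add: spline_space_def pieces_def)

section \<open>Order of the nodes and split points\<close>

lemma v_mono: "i \<le> j \<Longrightarrow> j \<le> n \<Longrightarrow> v i \<le> v j"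
  proof (induction j rule: dec_induct)
  case (step k)
  then show ?case using v_less[of k] by simp
qed simp

lemma v_strict_mono: "i < j \<Longrightarrow> j \<le> n \<Longrightarrow> v i < v j"
  using v_less[of i] v_mono[of "Suc i" j] by simp

lemma zeta_left_less: "0 < i \<Longrightarrow> i \<le> n \<Longrightarrow> zeta_left v \<zeta> i < v i"
  using split_point[of "i - 1"] by (simp add: zeta_left_def)

lemma zeta_right_greater: "i < n \<Longrightarrow> v i < zeta_right n v \<zeta> i"
  using split_point[of i] by (simp add: zeta_right_def)

text \<open>As n >= 1, no node is both first and last, so at least one of the two adjacent
  half-intervals is non-degenerate. This keeps the endpoints of \<open>S\<^sub>i\<close>
  distinct.\<close>

lemma zeta_left_less_right: "i \<le> n \<Longrightarrow> zeta_left v \<zeta> i < zeta_right n v \<zeta> i"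
  using zeta_left_less[of i] zeta_right_greater[of i] n_pos
  by (cases "i = 0"; cases "i = n") (auto simp: zeta_left_def zeta_right_def)

lemma interval_cover:
  assumes "x \<in> {v 0..v n}"
  obtains i where "i < n" "x \<in> {v i..v (Suc i)}"
proof -
  have "x \<in> {v 0..v m} \<Longrightarrow> 0 < m \<Longrightarrow> \<exists>i<m. x \<in> {v i..v (Suc i)}" for m
  proof (induction m)
    case (Suc m)
    show ?case
    proof (cases "m = 0 \<or> v m \<le> x")
      case True
      with Suc.prems show ?thesis by (intro exI[of _ m]) auto
    next
      case False
      with Suc show ?thesis by (meson atLeastAtMost_iff bot_nat_0.not_eq_extremum less_Suc_eq nle_le)
    qed
  qed simp
  with assms n_pos that show ?thesis by auto
qed

section \<open>Values and node derivatives read off from the pieces\<close>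

lemma pieces_left:
  "pieces s L R \<Longrightarrow> i < n \<Longrightarrow> x \<in> {\<zeta> i..v (Suc i)} \<Longrightarrow> s x = poly (L (Suc i)) x"
  using zeta_left_less[of "Suc i"] unfolding pieces_def by (force simp: zeta_left_def)

lemma pieces_right:
  "pieces s L R \<Longrightarrow> i < n \<Longrightarrow> x \<in> {v i..\<zeta> i} \<Longrightarrow> s x = poly (R i) x"
  using zeta_right_greater[of i] unfolding pieces_def by (force simp: zeta_right_def)

lemma pieces_vertex:
  "pieces s L R \<Longrightarrow> 0 < i \<Longrightarrow> i < n \<Longrightarrow> r \<le> \<phi> i - 1 \<Longrightarrow>
    poly ((pderiv ^^ r) (L i)) (v i) = poly ((pderiv ^^ r) (R i)) (v i)"
  unfolding pieces_def by blast

lemma pieces_split: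
  assumes "pieces s L R" "i < n"
  shows "poly (R i) (\<zeta> i) = poly (L (Suc i)) (\<zeta> i)"
    "poly (pderiv (R i)) (\<zeta> i) = poly (pderiv (L (Suc i))) (\<zeta> i)"
proof -
  have "\<forall>r\<le>1. poly ((pderiv ^^ r) (R i)) (\<zeta> i) = poly ((pderiv ^^ r) (L (Suc i))) (\<zeta> i)"
    using assms unfolding pieces_def by blast
  from this[rule_format, of 0] this[rule_format, of 1]
  show "poly (R i) (\<zeta> i) = poly (L (Suc i)) (\<zeta> i)"
    "poly (pderiv (R i)) (\<zeta> i) = poly (pderiv (L (Suc i))) (\<zeta> i)"
    by simp_all
qed

lemma deriv_on_pieces_right:
  assumes s: "pieces s L R" and i: "i < n" and j: "j \<le> \<phi> i - 1"
  shows "deriv_on (v 0) (v n) j s (v i) = poly ((pderiv ^^ j) (R i)) (v i)"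
proof (cases "i = 0")
  case True
  \<comment> \<open>The domain has no points left of \<open>v 0\<close>, so \<open>R i\<close> may
    serve as both pieces and any \<open>lo\<close> below \<open>v 0\<close> will do.\<close>
  have "deriv_on (v 0) (v n) j s (v i) =
    (if v i \<le> v i then poly ((pderiv ^^ j) (R i)) (v i) else poly ((pderiv ^^ j) (R i)) (v i))"
    by (rule deriv_on_piecewise[where lo = "v 0 - 1" and hi = "\<zeta> 0" and m = j])
      (use i True pieces_right[OF s] split_point[of 0] v_strict_mono[of 0 n] in auto)
  then show ?thesis by simp
next
  case False
  then obtain k where k: "i = Suc k" by (cases i) auto
  \<comment> \<open>Between the neighbouring split points only \<open>L i\<close> and
    \<open>R i\<close> occur, and they match at \<open>v i\<close> up to order
    \<open>\<phi> i - 1\<close>.\<close>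
  have "deriv_on (v 0) (v n) j s (v i) =
    (if v i \<le> v i then poly ((pderiv ^^ j) (L i)) (v i) else poly ((pderiv ^^ j) (R i)) (v i))"
    by (rule deriv_on_piecewise[where lo = "\<zeta> k" and hi = "\<zeta> i" and m = "\<phi> i - 1"])
      (use i j k pieces_right[OF s, of i] pieces_left[OF s, of k] pieces_vertex[OF s, of i]
        split_point[of i] split_point[of k] v_mono[of 0 i] v_strict_mono[of 0 n] v_mono[of i n] in auto)
  then show ?thesis using pieces_vertex[OF s _ i j] False by simp
qed

text \<open>Reaches the last node, which has only a left piece; at interior nodes the vertex
  conditions carry over the result for right pieces.\<close>

lemma deriv_on_pieces_left:
  assumes s: "pieces s L R" and i: "i < n" and j: "j \<le> \<phi> (Suc i) - 1"
  shows "deriv_on (v 0) (v n) j s (v (Suc i)) = poly ((pderiv ^^ j) (L (Suc i))) (v (Suc i))"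
proof (cases "Suc i = n")
  case True
  have "deriv_on (v 0) (v n) j s (v n) =
    (if v n \<le> v n then poly ((pderiv ^^ j) (L n)) (v n) else poly ((pderiv ^^ j) (L n)) (v n))"
    by (rule deriv_on_piecewise[where lo = "\<zeta> i" and hi = "v n + 1" and m = j])
      (use i True pieces_left[OF s, of i] split_point[of i] v_strict_mono[of 0 n] in auto)
  then show ?thesis using True by simp
next
  case False
  then show ?thesis
    using deriv_on_pieces_right[OF s _ j] pieces_vertex[OF s _ _ j] i by simp
qed

text \<open>The argument is local to one interval between consecutive nodes: the differences of the
  two pieces there are multiples of \<open>(x - v\<^sub>i)^m\<close> and
  \<open>(x - v\<^sub>i\<^sub>+\<^sub>1)^m'\<close>, and the C1 conditions at the split point force
  both factors to be 0.\<close>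

lemma pieces_unique:
  assumes s: "pieces s L R" and s': "pieces s' L' R'"
    and eq: "\<And>i j. i \<le> n \<Longrightarrow> j \<le> \<phi> i - 1 \<Longrightarrow>
      deriv_on (v 0) (v n) j s (v i) = deriv_on (v 0) (v n) j s' (v i)"
    and x: "x \<in> {v 0..v n}"
  shows "s x = s' x"
proof -
  obtain i where i: "i < n" "x \<in> {v i..v (Suc i)}"
    using x by (rule interval_cover)
  let ?m = "\<phi> i" and ?m' = "\<phi> (Suc i)"
  have "degree (R i - R' i) \<le> ?m" "degree (L (Suc i) - L' (Suc i)) \<le> ?m'"
    using s s' i unfolding pieces_def by (auto intro!: degree_diff_le)
  moreover have "poly ((pderiv ^^ j) (R i - R' i)) (v i) = 0" if "j < ?m" for j
    using that deriv_on_pieces_right[OF s i(1), of j] deriv_on_pieces_right[OF s' i(1), of j] eq[of i j] i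
    by (simp add: higher_pderiv_diff)
  moreover have "poly ((pderiv ^^ j) (L (Suc i) - L' (Suc i))) (v (Suc i)) = 0" if "j < ?m'" for j
    using that deriv_on_pieces_left[OF s i(1), of j] deriv_on_pieces_left[OF s' i(1), of j] eq[of "Suc i" j] i
    by (simp add: higher_pderiv_diff)
  ultimately obtain e e' where e: "R i - R' i = smult e ([:- v i, 1:] ^ ?m)"
    and e': "L (Suc i) - L' (Suc i) = smult e' ([:- v (Suc i), 1:] ^ ?m')"
    by (metis poly_with_high_order_zero)
  let ?h = "\<zeta> i - v i" and ?k = "\<zeta> i - v (Suc i)"
  have "poly (R i - R' i) (\<zeta> i) = poly (L (Suc i) - L' (Suc i)) (\<zeta> i)"
    "poly (pderiv (R i - R' i)) (\<zeta> i) = poly (pderiv (L (Suc i) - L' (Suc i))) (\<zeta> i)"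
    using pieces_split[OF s i(1)] pieces_split[OF s' i(1)] by (simp_all add: pderiv_diff)
  \<comment> \<open>With the second column negated, the determinant is exactly the one in
    \<open>split_system_det\<close>.\<close>
  then have "?h ^ ?m * e + (- (?k ^ ?m')) * e' = 0"
    "(real ?m * ?h ^ (?m - 1)) * e + (- (real ?m' * ?k ^ (?m' - 1))) * e' = 0"
    unfolding e e' pderiv_smult poly_smult pderiv_linear_power by (simp_all add: poly_power mult_ac)
  moreover have "?h ^ ?m * (- (real ?m' * ?k ^ (?m' - 1))) - (- (?k ^ ?m')) * (real ?m * ?h ^ (?m - 1)) \<noteq> 0"
    using split_system_det[of ?h ?k ?m ?m'] split_point[OF i(1)] \<phi>_ge[of i] \<phi>_ge[of "Suc i"] i
    by (simp add: algebra_simps)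
  ultimately have "e = 0" "e' = 0"
    using linear_system_2_unique by blast+
  then have "R i = R' i" "L (Suc i) = L' (Suc i)"
    using e e' by simp_all
  then show ?thesis
    using pieces_left[OF s i(1), of x] pieces_left[OF s' i(1), of x]
      pieces_right[OF s i(1), of x] pieces_right[OF s' i(1), of x] i(2)
    by (cases "x \<le> \<zeta> i") auto
qed

section \<open>Linear combinations of splines\<close>

lemma pieces_sum:
  assumes "finite K" and s: "\<And>k. k \<in> K \<Longrightarrow> pieces (s k) (L k) (R k)"
  shows "pieces (\<lambda>x. \<Sum>k\<in>K. c k * s k x)
    (\<lambda>i. \<Sum>k\<in>K. smult (c k) (L k i)) (\<lambda>i. \<Sum>k\<in>K. smult (c k) (R k i))"
  unfolding pieces_def higher_pderiv_sum higher_pderiv_smult poly_sum poly_smult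
proof (intro conjI allI impI ballI)
  fix i assume "i \<le> n"
  then show "degree (\<Sum>k\<in>K. smult (c k) (L k i)) \<le> \<phi> i" "degree (\<Sum>k\<in>K. smult (c k) (R k i)) \<le> \<phi> i"
    using s unfolding pieces_def
    by (auto intro!: degree_sum_le \<open>finite K\<close> order_trans[OF degree_smult_le])
next
  fix i x assume *: "i \<le> n" "zeta_left v \<zeta> i < v i" "x \<in> {zeta_left v \<zeta> i..v i}"
  show "(\<Sum>k\<in>K. c k * s k x) = (\<Sum>k\<in>K. c k * poly (L k i) x)"
    using s * unfolding pieces_def by (intro sum.cong refl) simp
next
  fix i x assume *: "i \<le> n" "v i < zeta_right n v \<zeta> i" "x \<in> {v i..zeta_right n v \<zeta> i}"
  show "(\<Sum>k\<in>K. c k * s k x) = (\<Sum>k\<in>K. c k * poly (R k i) x)"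
    using s * unfolding pieces_def by (intro sum.cong refl) simp
next
  fix i r assume *: "0 < i \<and> i < n" "r \<le> \<phi> i - 1"
  show "(\<Sum>k\<in>K. c k * poly ((pderiv ^^ r) (L k i)) (v i)) = (\<Sum>k\<in>K. c k * poly ((pderiv ^^ r) (R k i)) (v i))"
    using s * unfolding pieces_def by (intro sum.cong refl) simp
next
  fix i r :: nat assume *: "i < n" "r \<le> 1"
  show "(\<Sum>k\<in>K. c k * poly ((pderiv ^^ r) (R k i)) (\<zeta> i)) =
      (\<Sum>k\<in>K. c k * poly ((pderiv ^^ r) (L k (Suc i))) (\<zeta> i))"
    using s * unfolding pieces_def by (intro sum.cong refl) simp
qed

text \<open>\<open>vector_derivative\<close> is additive only where derivatives exist, so the sum is
  differentiated through its polynomial pieces: the right one, or the left one at the last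
  node.\<close>

lemma deriv_on_pieces_sum:
  assumes K: "finite K" and s: "\<And>k. k \<in> K \<Longrightarrow> pieces (s k) (L k) (R k)"
    and i: "i \<le> n" and j: "j \<le> \<phi> i - 1"
  shows "deriv_on (v 0) (v n) j (\<lambda>x. \<Sum>k\<in>K. c k * s k x) (v i) =
    (\<Sum>k\<in>K. c k * deriv_on (v 0) (v n) j (s k) (v i))"
proof (cases "i < n")
  case True
  show ?thesis
    using deriv_on_pieces_right[OF pieces_sum[of K s L R c, OF K s] True j]
      deriv_on_pieces_right[OF s True j]
    by (simp add: higher_pderiv_sum higher_pderiv_smult poly_sum)
next
  case False
  then obtain k where k: "i = Suc k" "k < n" using i n_pos by (cases i) auto
  show ?thesis
    using deriv_on_pieces_left[OF pieces_sum[of K s L R c, OF K s] k(2) j[unfolded k]]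
      deriv_on_pieces_left[OF s k(2) j[unfolded k]] k
    by (simp add: higher_pderiv_sum higher_pderiv_smult poly_sum)
qed

lemma hermite_spline_exists:
  fixes c :: "nat \<Rightarrow> nat \<Rightarrow> real"
  shows "\<exists>s\<in>spline_space n v \<zeta> \<phi>. \<forall>i\<le>n. \<forall>j\<le>\<phi> i - 1. deriv_on (v 0) (v n) j s (v i) = c i j"
proof -
  \<comment> \<open>\<open>T i\<close> carries the prescribed data at \<open>v i\<close>. The extra
    term in \<open>W\<close> leaves them unchanged and supplies the one free coefficient of a
    piece.\<close>
  define T where "T i = (\<Sum>l<\<phi> i. smult (c i l / fact l) ([:- v i, 1:] ^ l))" for i
  define W where "W i e = T i + smult e ([:- v i, 1:] ^ \<phi> i)" for i e
  have W_deriv: "poly ((pderiv ^^ j) (W i e)) (v i) = c i j" if "j < \<phi> i" for i j e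
    using that by (simp add: W_def T_def higher_pderiv_add higher_pderiv_smult
        poly_higher_pderiv_taylor poly_higher_pderiv_linear_power)
  have W_degree: "degree (W i e) \<le> \<phi> i" for i e
    unfolding W_def T_def
    by (intro degree_add_le degree_taylor order_trans[OF degree_smult_le]) (simp add: degree_linear_power)
  have "\<exists>z. i < n \<longrightarrow> poly (W i (fst z)) (\<zeta> i) = poly (W (Suc i) (snd z)) (\<zeta> i) \<and>
      poly (pderiv (W i (fst z))) (\<zeta> i) = poly (pderiv (W (Suc i) (snd z))) (\<zeta> i)" for i
  proof (cases "i < n")
    case True
    let ?m = "\<phi> i" and ?m' = "\<phi> (Suc i)"
    let ?h = "\<zeta> i - v i" and ?k = "\<zeta> i - v (Suc i)"
    have "?h ^ ?m * (- (real ?m' * ?k ^ (?m' - 1))) - (- (?k ^ ?m')) * (real ?m * ?h ^ (?m - 1)) \<noteq> 0"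
      using split_system_det[of ?h ?k ?m ?m'] split_point[OF True] \<phi>_ge[of i] \<phi>_ge[of "Suc i"] True
      by (simp add: algebra_simps)
    then obtain e e' where
      "?h ^ ?m * e + (- (?k ^ ?m')) * e' = poly (T (Suc i)) (\<zeta> i) - poly (T i) (\<zeta> i)"
      "(real ?m * ?h ^ (?m - 1)) * e + (- (real ?m' * ?k ^ (?m' - 1))) * e' =
         poly (pderiv (T (Suc i))) (\<zeta> i) - poly (pderiv (T i)) (\<zeta> i)"
      by (rule linear_system_2_solvable)
    then show ?thesis
      unfolding W_def pderiv_add pderiv_smult poly_add poly_smult pderiv_linear_power
      by (intro exI[of _ "(e, e')"]) (simp add: poly_power algebra_simps)
  qed auto
  then obtain z where z: "\<And>i. i < n \<Longrightarrow> poly (W i (fst (z i))) (\<zeta> i) = poly (W (Suc i) (snd (z i))) (\<zeta> i)"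
    "\<And>i. i < n \<Longrightarrow> poly (pderiv (W i (fst (z i)))) (\<zeta> i) = poly (pderiv (W (Suc i) (snd (z i)))) (\<zeta> i)"
    by metis
  define R where "R i = W i (fst (z i))" for i
  \<comment> \<open>The piece left of \<open>v i\<close> belongs to the split point with index i -
    1. For i = 0 the truncated index gives \<open>z 0\<close>; that piece lies over a degenerate
    interval.\<close>
  define L where "L i = W i (snd (z (i - 1)))" for i
  have match: "poly ((pderiv ^^ r) (R i)) (\<zeta> i) = poly ((pderiv ^^ r) (L (Suc i))) (\<zeta> i)"
    if "i < n" "r \<le> 1" for i r
    using that z[of i] by (cases r) (auto simp: R_def L_def)
  have vertex: "poly ((pderiv ^^ r) (L i)) (v i) = poly ((pderiv ^^ r) (R i)) (v i)" if "r < \<phi> i" for i r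
    using that by (simp add: R_def L_def W_deriv)
  define piece where "piece i x = (if x \<le> \<zeta> i then poly (R i) x else poly (L (Suc i)) x)" for i x
  \<comment> \<open>The least index selects an interval containing \<open>x\<close>, the left one at
    an interior node. Both neighbours have value \<open>c i 0\<close> there, so the choice does not
    affect \<open>s\<close>.\<close>
  define s where "s = restrict (\<lambda>x. piece (LEAST i. x \<le> v (Suc i)) x) {v 0..v n}"
  have left_end: "piece i (v i) = c i 0" if "i < n" for i
    using that split_point[of i] W_deriv[of 0 i] \<phi>_ge[of i] by (force simp: piece_def R_def)
  have right_end: "piece i (v (Suc i)) = c (Suc i) 0" if "i < n" for i
    using that split_point[of i] W_deriv[of 0 "Suc i"] \<phi>_ge[of "Suc i"] by (force simp: piece_def L_def)
  have s_eq: "s x = piece i x" if i: "i < n" "x \<in> {v i..v (Suc i)}" for i x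
  proof -
    have x: "x \<in> {v 0..v n}" using i v_mono[of 0 i] v_mono[of "Suc i" n] by auto
    show ?thesis
    proof (cases "x = v i \<and> i > 0")
      case True
      then obtain k where k: "i = Suc k" by (cases i) auto
      have "(LEAST i. x \<le> v (Suc i)) = k"
      proof (rule Least_equality)
        fix y assume "x \<le> v (Suc y)"
        then show "k \<le> y"
          using v_strict_mono[of "Suc y" i] True k i by (meson Suc_leI Suc_less_eq leD leI less_imp_le)
      qed (use True k in simp)
      then show ?thesis
        using x True k i left_end[of i] right_end[of k] by (simp add: s_def)
    next
      case False
      have "(LEAST i. x \<le> v (Suc i)) = i"
      proof (rule Least_equality)
        fix y assume "x \<le> v (Suc y)"
        show "i \<le> y"
        proof (rule ccontr)
          assume "\<not> i \<le> y"
          then have "v (Suc y) \<le> v i" using v_mono[of "Suc y" i] i by simp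
          then show False using False i \<open>x \<le> v (Suc y)\<close> \<open>\<not> i \<le> y\<close> by auto
        qed
      qed (use i in simp)
      then show ?thesis using x by (simp add: s_def)
    qed
  qed
  have "pieces s L R"
    unfolding pieces_def
  proof (intro conjI allI impI ballI)
    fix i x assume *: "i \<le> n" "zeta_left v \<zeta> i < v i" "x \<in> {zeta_left v \<zeta> i..v i}"
    then obtain k where k: "i = Suc k" by (cases i) (auto simp: zeta_left_def)
    then have "s x = piece k x"
      using * split_point[of k] by (intro s_eq) (auto simp: zeta_left_def)
    \<comment> \<open>At the split point itself \<open>piece\<close> uses the right piece
      \<open>R k\<close>; \<open>match\<close> with order 0 identifies the two values.\<close>
    then show "s x = poly (L i) x"
      using * k match[of k 0] by (auto simp: piece_def zeta_left_def)
  next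
    fix i x assume *: "i \<le> n" "v i < zeta_right n v \<zeta> i" "x \<in> {v i..zeta_right n v \<zeta> i}"
    then have i: "i < n" by (auto simp: zeta_right_def split: if_splits)
    then have "s x = piece i x"
      using * split_point[of i] by (intro s_eq) (auto simp: zeta_right_def)
    then show "s x = poly (R i) x"
      using * i by (auto simp: piece_def zeta_right_def)
  next
    fix i r assume "0 < i \<and> i < n" "r \<le> \<phi> i - 1"
    then show "poly ((pderiv ^^ r) (L i)) (v i) = poly ((pderiv ^^ r) (R i)) (v i)"
      using vertex[of r i] \<phi>_ge[of i] by simp
  next
    fix i r :: nat assume "i < n" "r \<le> 1"
    then show "poly ((pderiv ^^ r) (R i)) (\<zeta> i) = poly ((pderiv ^^ r) (L (Suc i))) (\<zeta> i)"
      by (rule match)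
  qed (auto simp: R_def L_def W_degree)
  moreover have "s \<in> extensional {v 0..v n}"
    by (simp add: s_def)
  moreover have "deriv_on (v 0) (v n) j s (v i) = c i j" if ij: "i \<le> n" "j \<le> \<phi> i - 1" for i j
  proof (cases "i < n")
    case True
    then show ?thesis
      using deriv_on_pieces_right[OF \<open>pieces s L R\<close> True ij(2)] W_deriv[of j i] \<phi>_ge[of i] ij
      by (simp add: R_def)
  next
    case False
    then obtain k where k: "i = Suc k" "k < n" using ij n_pos by (cases i) auto
    then show ?thesis
      using deriv_on_pieces_left[OF \<open>pieces s L R\<close> k(2)] W_deriv[of j i] \<phi>_ge[of i] ij
      by (simp add: L_def)
  qed
  ultimately show ?thesis
    using spline_space_iff by blast
qed

lemma hermite_spline_unique:
  assumes "s \<in> spline_space n v \<zeta> \<phi>" "s' \<in> spline_space n v \<zeta> \<phi>"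
    and "\<And>i j. i \<le> n \<Longrightarrow> j \<le> \<phi> i - 1 \<Longrightarrow>
      deriv_on (v 0) (v n) j s (v i) = deriv_on (v 0) (v n) j s' (v i)"
  shows "s = s'"
proof (rule extensionalityI)
  show "s \<in> extensional {v 0..v n}" "s' \<in> extensional {v 0..v n}"
    using assms spline_space_iff by blast+
  show "s x = s' x" if "x \<in> {v 0..v n}" for x
    using assms that pieces_unique spline_space_iff by metis
qed

subsection \<open>Reproduction of polynomials\<close>

text \<open>The conditions at node \<open>i\<close> and at the other nodes merge into one Hermite
  problem with data \<open>?c\<close>, whose unique solvability justifies the definite
  description.\<close>

lemma bspline_properties:
  fixes \<alpha> :: "nat \<times> nat"
  assumes i: "i \<le> n"
  defines "N \<equiv> bspline n v \<zeta> \<phi> i \<alpha>"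
  shows "N \<in> spline_space n v \<zeta> \<phi>"
    and "\<And>k j. k \<le> n \<Longrightarrow> j \<le> \<phi> k - 1 \<Longrightarrow>
      deriv_on (v 0) (v n) j N (v k) = (if k = i then gamma_coeff n v \<zeta> \<phi> i \<alpha> j else 0)"
proof -
  let ?c = "\<lambda>k j. if k = i then gamma_coeff n v \<zeta> \<phi> i \<alpha> j else 0"
  let ?H = "\<lambda>s. s \<in> spline_space n v \<zeta> \<phi> \<and>
    (\<forall>k\<le>n. \<forall>j\<le>\<phi> k - 1. deriv_on (v 0) (v n) j s (v k) = ?c k j)"
  have "N = (THE s. ?H s)"
    unfolding N_def bspline_def
  proof (rule arg_cong[where f = The], rule ext)
    fix s
    show "(s \<in> spline_space n v \<zeta> \<phi> \<and>
        (\<forall>j\<le>\<phi> i - 1. deriv_on (v 0) (v n) j s (v i) = gamma_coeff n v \<zeta> \<phi> i \<alpha> j) \<and>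
        (\<forall>k\<le>n. k \<noteq> i \<longrightarrow> (\<forall>j\<le>\<phi> k - 1. deriv_on (v 0) (v n) j s (v k) = 0))) = ?H s"
      using i by auto
  qed
  moreover have "\<exists>!s. ?H s"
  proof (rule ex_ex1I)
    show "\<exists>s. ?H s" using hermite_spline_exists[of ?c] by blast
    show "s = s'" if "?H s" "?H s'" for s s'
      using that by (intro hermite_spline_unique) auto
  qed
  ultimately have H: "?H N"
    using theI'[of ?H] by simp
  show "N \<in> spline_space n v \<zeta> \<phi>" using H by blast
  show "deriv_on (v 0) (v n) j N (v k) = ?c k j" if "k \<le> n" "j \<le> \<phi> k - 1" for k j
    using H that by blast
qed

lemma pieces_poly:
  assumes "\<And>i. i \<le> n \<Longrightarrow> degree p \<le> \<phi> i"
  shows "pieces (poly p) (\<lambda>_. p) (\<lambda>_. p)"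
  using assms by (simp add: pieces_def)

text \<open>The substitution l = m - 1 - k turns (k + 1)! into (m - l)!. Since (m - l)!/m! = 1/(l!
  (m choose l)), the sum is the polar form of the Taylor polynomial, with the remaining argument
  placed at \<open>v i\<close>.\<close>

lemma nu_eq:
  assumes i: "i \<le> n"
  shows "nu n v \<zeta> \<phi> i \<alpha> f =
    (\<Sum>l<\<phi> i. fact (\<phi> i - l) / fact (\<phi> i) * deriv_on (v 0) (v n) l f (v i) *
       elem_sym l (zeta_left v \<zeta> i - v i) (zeta_right n v \<zeta> i - v i) \<alpha>)"
proof -
  let ?m = "\<phi> i" and ?\<delta> = "zeta_left v \<zeta> i - v i" and ?\<epsilon> = "zeta_right n v \<zeta> i - v i"
  let ?D = "\<lambda>l. deriv_on (v 0) (v n) l f (v i)"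
  have m: "?m \<ge> 2" using \<phi>_ge[OF i] .
  have inner: "(\<Sum>\<beta>\<in>multi_indices l. real (fst \<alpha> choose fst \<beta>) * real (snd \<alpha> choose snd \<beta>) *
      ?\<delta> ^ fst \<beta> * ?\<epsilon> ^ snd \<beta> * deriv_on (v 0) (v n) (fst \<beta> + snd \<beta>) f (v i)) =
      ?D l * elem_sym l ?\<delta> ?\<epsilon> \<alpha>" for l
    unfolding elem_sym_def sum_distrib_left
    by (intro sum.cong refl) (auto simp: multi_indices_def)
  have "nu n v \<zeta> \<phi> i \<alpha> f =
      (\<Sum>k=0..?m - 1. fact (k + 1) / fact ?m * (?D (?m - 1 - k) * elem_sym (?m - 1 - k) ?\<delta> ?\<epsilon> \<alpha>))"
    unfolding nu_def blossom_at_def inner ..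
  also have "\<dots> = (\<Sum>l<?m. fact (?m - l) / fact ?m * ?D l * elem_sym l ?\<delta> ?\<epsilon> \<alpha>)"
    using m by (intro sum.reindex_bij_witness[of _ "\<lambda>l. ?m - 1 - l" "\<lambda>k. ?m - 1 - k"])
      (auto simp: Suc_diff_Suc)
  finally show ?thesis .
qed

text \<open>The factors in \<open>gamma_coeff\<close> undo the passage from \<open>f\<close> to \<open>x \<mapsto> N[f](v\<^sub>i, x[\<phi> i - 1])\<close>,
  dilated by \<open>\<theta>\<^sub>i\<close>, whose Bezier ordinates over \<open>S\<^sub>i\<close> are the \<open>nu\<close>.\<close>

lemma sum_nu_gamma:
  assumes i: "i \<le> n" and j: "j \<le> \<phi> i - 1"
  shows "(\<Sum>\<alpha>\<in>multi_indices (\<phi> i - 1). nu n v \<zeta> \<phi> i \<alpha> f * gamma_coeff n v \<zeta> \<phi> i \<alpha> j)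
    = deriv_on (v 0) (v n) j f (v i)"
proof -
  define m where "m = \<phi> i"
  define \<theta> where "\<theta> = theta \<phi> i"
  define \<delta> \<epsilon> where "\<delta> = zeta_left v \<zeta> i - v i" and "\<epsilon> = zeta_right n v \<zeta> i - v i"
  define D where "D l = deriv_on (v 0) (v n) l f (v i)" for l
  define q where "q = real (m choose j) / real ((m - 1) choose j)"
  have m: "m \<ge> 2" "j < m" using \<phi>_ge[OF i] j by (auto simp: m_def)
  have \<theta>: "\<theta> \<noteq> 0" using m by (simp add: \<theta>_def theta_def m_def)
  have \<delta>\<epsilon>: "\<delta> \<noteq> \<epsilon>" using zeta_left_less_right[OF i] by (simp add: \<delta>_def \<epsilon>_def)
  have S: "S_left v \<zeta> \<phi> i = v i + \<theta> * \<delta>" "S_right n v \<zeta> \<phi> i = v i + \<theta> * \<epsilon>"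
    by (simp_all add: S_left_def S_right_def \<theta>_def \<delta>_def \<epsilon>_def algebra_simps)
  have "(\<Sum>\<alpha>\<in>multi_indices (m - 1). nu n v \<zeta> \<phi> i \<alpha> f * gamma_coeff n v \<zeta> \<phi> i \<alpha> j) =
    q * \<theta> ^ j * (\<Sum>\<alpha>\<in>multi_indices (m - 1). (\<Sum>l<m. (fact (m - l) / fact m * D l) * elem_sym l \<delta> \<epsilon> \<alpha>) *
       (deriv ^^ j) (bernstein_on (m - 1) \<alpha> (v i + \<theta> * \<delta>) (v i + \<theta> * \<epsilon>)) (v i))"
    unfolding nu_eq[OF i] gamma_coeff_def S sum_distrib_left
    by (simp add: m_def \<theta>_def \<delta>_def \<epsilon>_def D_def q_def mult_ac)
  also have "\<dots> = q * \<theta> ^ j * (fact j * (fact (m - j) / fact m * D j) * real (m - 1 choose j) / \<theta> ^ j)"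
    by (subst sum_elem_sym_deriv_bernstein[OF \<theta> \<delta>\<epsilon> m(2)]) simp
  \<comment> \<open>The powers of \<theta> cancel because \<theta> is nonzero for m >= 2, and
    \<open>q\<close> trades \<open>m - 1 choose j\<close>, nonzero for j < m, for
    \<open>m choose j\<close>.\<close>
  also have "\<dots> = (fact j * fact (m - j) * real (m choose j)) / fact m * D j"
    using \<theta> m by (simp add: q_def)
  also have "fact j * fact (m - j) * real (m choose j) = fact m"
    using binomial_fact_lemma[of j m] m by (metis less_imp_le of_nat_fact of_nat_mult)
  finally show ?thesis
    by (simp add: D_def m_def)
qed

lemma quasi_interpolant_reproduces:
  assumes deg: "\<And>i. i \<le> n \<Longrightarrow> degree p \<le> \<phi> i" and x: "x \<in> {v 0..v n}"
  shows "quasi_interpolant n v \<zeta> \<phi> (poly p) x = poly p x"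
proof -
  \<comment> \<open>The double sum becomes one sum over pairs, the shape required by
    \<open>pieces_sum\<close>.\<close>
  define K where "K = Sigma {0..n} (\<lambda>i. multi_indices (\<phi> i - 1))"
  define c where "c k = nu n v \<zeta> \<phi> (fst k) (snd k) (poly p)" for k
  define N where "N k = bspline n v \<zeta> \<phi> (fst k) (snd k)" for k
  have K: "finite K" by (simp add: K_def)
  have "\<exists>LR. pieces (N k) (fst LR) (snd LR)" if "k \<in> K" for k
    using bspline_properties(1)[of "fst k" "snd k"] that spline_space_iff by (auto simp: K_def N_def)
  then obtain LR where LR: "\<And>k. k \<in> K \<Longrightarrow> pieces (N k) (fst (LR k)) (snd (LR k))"
    by metis
  let ?Q = "\<lambda>x. \<Sum>k\<in>K. c k * N k x"
  have "?Q x = poly p x"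
  proof (rule pieces_unique[OF pieces_sum[OF K LR] pieces_poly[OF deg] _ x])
    fix i j assume ij: "i \<le> n" "j \<le> \<phi> i - 1"
    have "deriv_on (v 0) (v n) j ?Q (v i) = (\<Sum>k\<in>K. c k * deriv_on (v 0) (v n) j (N k) (v i))"
      by (rule deriv_on_pieces_sum[OF K LR ij])
    also have "\<dots> = (\<Sum>i'=0..n. \<Sum>\<alpha>\<in>multi_indices (\<phi> i' - 1). nu n v \<zeta> \<phi> i' \<alpha> (poly p) *
        deriv_on (v 0) (v n) j (bspline n v \<zeta> \<phi> i' \<alpha>) (v i))"
      by (subst sum.Sigma) (auto simp: K_def c_def N_def case_prod_beta)
    \<comment> \<open>B-splines attached to other nodes have vanishing derivatives at
      \<open>v i\<close>, so only the block of node \<open>i\<close> survives.\<close>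
    also have "\<dots> = (\<Sum>i'=0..n. if i' = i then \<Sum>\<alpha>\<in>multi_indices (\<phi> i - 1).
        nu n v \<zeta> \<phi> i \<alpha> (poly p) * gamma_coeff n v \<zeta> \<phi> i \<alpha> j else 0)"
      using ij by (intro sum.cong refl) (auto simp: bspline_properties(2))
    also have "\<dots> = deriv_on (v 0) (v n) j (poly p) (v i)"
      using ij sum_nu_gamma[OF ij] by simp
    finally show "deriv_on (v 0) (v n) j ?Q (v i) = deriv_on (v 0) (v n) j (poly p) (v i)" .
  qed
  moreover have "quasi_interpolant n v \<zeta> \<phi> (poly p) x = ?Q x"
    unfolding quasi_interpolant_def by (subst sum.Sigma) (auto simp: K_def c_def N_def case_prod_beta)
  ultimately show ?thesis by simp
qed

end

theorem corollary1:
  fixes n :: nat and a b :: real and v \<zeta> :: "nat \<Rightarrow> real" and \<phi> :: "nat \<Rightarrow> nat"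
  assumes "n \<ge> 1"
    and "v 0 = a" and "v n = b"
    and "\<And>i. i < n \<Longrightarrow> v i < v (Suc i)"
    and "\<And>i. i < n \<Longrightarrow> \<zeta> i \<in> {v i<..<v (Suc i)}"
    and "\<And>i. i \<le> n \<Longrightarrow> \<phi> i \<ge> 2"
  shows "\<forall>p :: real poly. degree p \<le> Min (\<phi> ` {0..n}) \<longrightarrow>
           (\<forall>x\<in>{a..b}. quasi_interpolant n v \<zeta> \<phi> (poly p) x = poly p x)"
proof (intro allI impI ballI)
  fix p :: "real poly" and x
  assume p: "degree p \<le> Min (\<phi> ` {0..n})" and x: "x \<in> {a..b}"
  interpret refined_partition n v \<zeta> \<phi>
    using assms by unfold_locales
  have "degree p \<le> \<phi> i" if "i \<le> n" for i
    using p that by simp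
  then show "quasi_interpolant n v \<zeta> \<phi> (poly p) x = poly p x"
    using x assms(2,3) by (intro quasi_interpolant_reproduces) auto
qed

end
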